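(* Let $k\geq 2$ be an integer and let $(x_n)_{n\in\mathbb{N}}\subseteq[0,1]$ be a sequence with Poissonian $k$-th order correlations. Then $(x_n)_{n\in\mathbb{N}}$ is uniformly distributed in $[0,1]$, i.e. for all $0\le a<b\le 1$, $\lim_{N\to\infty}\frac1N\#\{n\le N: a\le x_n\le b\}=b-a$.
   Context: For $x\in\mathbb{R}$, $\{x\}$ is the fractional part of $x$ and $(\!(x)\!)$ is the signed distance of $x$ from the origin modulo $1$: $(\!(x)\!)=\{x\}$ if $0\le\{x\}\le\tfrac12$ and $(\!(x)\!)=\{x\}-1$ if $\tfrac12<\{x\}<1$. For a compactly supported $f:\mathbb{R}^{k-1}\to[0,\infty)$ the $k$-th order correlation function is $R_k(f,N)=\frac1N\sum_{i_1,\dots,i_k\le N \text{ pairwise distinct}} f\big(N(\!(x_{i_1}-x_{i_2})\!),N(\!(x_{i_1}-x_{i_3})\!),\dots,N(\!(x_{i_1}-x_{i_k})\!)\big)$. The sequence has Poissonian $k$-th order correlations if $\lim_{N\to\infty}R_k(f,N)=\int_{\mathbb{R}^{k-1}}f(x)\,dx$ for every $f\in C_c(\mathbb{R}^{k-1})$ (continuous, compactly supported, here non-negative). *)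

theory Defs
  imports "HOL-Analysis.Analysis"
begin

text \<open>
  Sequences \<open>x\<^sub>1, x\<^sub>2, \<dots>\<close> are functions \<^typ>\<open>nat \<Rightarrow> real\<close> of which the value at \<open>0\<close> is
  never used. The space \<open>\<real>\<^bsup>k-1\<^esup>\<close> is rendered as \<open>real ^ 'n\<close>, where the finite type \<open>'n\<close> has
  \<open>k - 1\<close> elements and plays the role of the positions \<open>2, \<dots>, k\<close> in a \<open>k\<close>-tuple of indices;
  the order of the correlation is thus determined by the type.
\<close>

definition signed_dist :: "real \<Rightarrow> real" where
  "signed_dist t = (if frac t \<le> 1 / 2 then frac t else frac t - 1)"

text \<open>
  A pair \<open>(i, j)\<close> stands for the tuple of pairwise distinct indices whose first entry is \<open>i\<close>
  and whose remaining entries are the values of \<open>j\<close>.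
\<close>

definition distinct_indices :: "nat \<Rightarrow> (nat \<times> ('n \<Rightarrow> nat)) set" where
  "distinct_indices N =
     {(i, j). i \<in> {1..N} \<and> (\<forall>m. j m \<in> {1..N}) \<and> (\<forall>m. j m \<noteq> i) \<and> inj j}"

definition correlation :: "(nat \<Rightarrow> real) \<Rightarrow> (real ^ 'n::finite \<Rightarrow> real) \<Rightarrow> nat \<Rightarrow> real" where
  "correlation x f N =
     (1 / real N) * (\<Sum>(i, j)\<in>distinct_indices N. f (\<chi> m. real N * signed_dist (x i - x (j m))))"

definition poissonian_correlations :: "'n::finite itself \<Rightarrow> (nat \<Rightarrow> real) \<Rightarrow> bool" where
  "poissonian_correlations _ x \<longleftrightarrow>
     (\<forall>f :: real ^ 'n \<Rightarrow> real.
        continuous_on UNIV f \<and> compact (closure {v. f v \<noteq> 0}) \<and> (\<forall>v. 0 \<le> f v) \<longrightarrow>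
        correlation x f \<longlonglongrightarrow> (\<integral>v. f v \<partial>lborel))"

definition uniformly_distributed :: "(nat \<Rightarrow> real) \<Rightarrow> bool" where
  "uniformly_distributed x \<longleftrightarrow>
     (\<forall>a b. 0 \<le> a \<and> a < b \<and> b \<le> 1 \<longrightarrow>
        (\<lambda>N. (1 / real N) * real (card {n \<in> {1..N}. a \<le> x n \<and> x n \<le> b})) \<longlonglongrightarrow> b - a)"

end

theory Submission
  imports Defs "HOL-Real_Asymp.Real_Asymp"
begin

text \<open>
  Put \<open>d = k - 1\<close>, \<open>h = L / N\<close> and let \<open>Y(t)\<close> be the number of \<open>n \<le> N\<close> with \<open>t \<le> x\<^sub>n \<le> t + h\<close>.
  Integrating over \<open>t\<close> the number of \<open>k\<close>-tuples of distinct indices hit by \<open>[t, t + h]\<close> gives a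
  quantity bounded by a correlation function whose kernel has integral \<open>L\<^sup>k\<close>, so
  \<open>W = max 0 (Y - d) / L\<close> has \<open>\<integral> W\<^sup>k \<le> 1 + o(1)\<close>, while \<open>\<integral> Y = L\<close> yields
  \<open>\<integral> W \<ge> 1 - (1 + h) d / L\<close>. By the quantitative Bernoulli inequality
  \<open>(z - 1)\<^sup>2 \<le> z\<^sup>k - 1 - k (z - 1)\<close> the function \<open>W\<close> is then close to \<open>1\<close> in mean over \<open>[- h, 1]\<close>
  once \<open>L\<close> is large, and its averages over \<open>[a, b]\<close> approximate the proportion of points there.
\<close>

section \<open>Overlap kernel of translated intervals: continuity, support, integral\<close>

lemma continuous_on_Max_insert:
  fixes f :: "'i \<Rightarrow> 'a::topological_space \<Rightarrow> real"
  assumes "finite S" "continuous_on A g" "\<And>i. i \<in> S \<Longrightarrow> continuous_on A (f i)"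
  shows "continuous_on A (\<lambda>u. Max (insert (g u) ((\<lambda>i. f i u) ` S)))"
  using assms
proof (induction S arbitrary: g rule: finite_induct)
  case (insert a S)
  have "Max (insert (g u) ((\<lambda>i. f i u) ` insert a S)) =
        max (f a u) (Max (insert (g u) ((\<lambda>i. f i u) ` S)))" for u
    using insert.hyps by (simp add: insert_commute[of "g u"] del: Max_insert) (subst Max_insert, auto)
  with insert show ?case
    by (auto intro!: continuous_on_max)
qed simp

text \<open>This is the intersection of \<open>[0, L]\<close> with its translates
  \<open>[u $ m, u $ m + L]\<close>. Its length, as a function of \<open>u\<close>, is a multiple
  correlation of the indicator of \<open>[0, L]\<close> with itself; for a single coordinate it is
  the tent \<open>max 0 (L - |u|)\<close>.\<close>

definition translations_within :: "real \<Rightarrow> real ^ 'n \<Rightarrow> real set" where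
  "translations_within L u = {s. 0 \<le> s \<and> s \<le> L \<and> (\<forall>m. 0 \<le> s - u $ m \<and> s - u $ m \<le> L)}"

definition overlap :: "real \<Rightarrow> real ^ 'n::finite \<Rightarrow> real" where
  "overlap L u = measure lborel (translations_within L u)"

lemma translations_within_eq:
  fixes u :: "real ^ 'n::finite"
  shows "translations_within L u =
    {Max (insert 0 (range (\<lambda>m. u $ m))) .. L - Max (insert 0 (range (\<lambda>m. - u $ m)))}"
proof -
  have "s \<in> translations_within L u \<longleftrightarrow>
      Max (insert 0 (range (\<lambda>m. u $ m))) \<le> s \<and> Max (insert 0 (range (\<lambda>m. - u $ m))) \<le> L - s" for s
    by (subst (1 2) Max_le_iff) (auto simp: translations_within_def algebra_simps)
  then have "s \<in> translations_within L u \<longleftrightarrow>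
      s \<in> {Max (insert 0 (range (\<lambda>m. u $ m))) .. L - Max (insert 0 (range (\<lambda>m. - u $ m)))}" for s
    unfolding atLeastAtMost_iff by (simp only: le_diff_eq add.commute)
  then show ?thesis
    by blast
qed

text \<open>The \<open>max 0\<close> accounts for an empty intersection. In this closed form the
  continuity of the kernel is visible.\<close>

lemma overlap_eq:
  fixes u :: "real ^ 'n::finite"
  shows "overlap L u =
    max 0 (L - Max (insert 0 (range (\<lambda>m. - u $ m))) - Max (insert 0 (range (\<lambda>m. u $ m))))"
proof -
  have "measure lborel {a..b} = max 0 (b - a)" for a b :: real
    by (cases "a \<le> b") auto
  then show ?thesis
    unfolding overlap_def translations_within_eq .
qed

lemma overlap_nonneg: "0 \<le> overlap L u"
  by (simp add: overlap_def)

lemma continuous_on_overlap: "continuous_on A (overlap L)"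
  unfolding overlap_eq[abs_def] by (intro continuous_intros continuous_on_Max_insert) auto

text \<open>If the kernel is nonzero, some \<open>s\<close> lies in \<open>[0, L]\<close> and in all
  translates, which confines every coordinate of \<open>u\<close> to
  \<open>[- L, L]\<close>.\<close>

lemma compact_support_overlap:
  fixes L :: real
  shows "compact (closure {u :: real ^ 'n::finite. overlap L u \<noteq> 0})"
proof -
  have "{u :: real ^ 'n. overlap L u \<noteq> 0} \<subseteq> cbox (vec (- L)) (vec L)"
  proof
    fix u :: "real ^ 'n" assume "u \<in> {u. overlap L u \<noteq> 0}"
    then have "translations_within L u \<noteq> {}"
      by (auto simp: overlap_def)
    then obtain s where s: "0 \<le> s" "s \<le> L" "\<And>m. 0 \<le> s - u $ m \<and> s - u $ m \<le> L"
      by (auto simp: translations_within_def)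
    have "- L \<le> u $ m \<and> u $ m \<le> L" for m
      using s(1,2) s(3)[of m] by linarith
    then show "u \<in> cbox (vec (- L)) (vec L)"
      by (simp add: mem_box_cart)
  qed
  then show ?thesis
    unfolding compact_closure by (rule bounded_subset[OF bounded_cbox])
qed

text \<open>Fubini on pairs \<open>(u, s)\<close>: for fixed \<open>s\<close> in
  \<open>[0, L]\<close> the admissible \<open>u\<close> form a cube of side \<open>L\<close>, and
  for other \<open>s\<close> there are none.\<close>

lemma nn_integral_overlap:
  fixes L :: real
  assumes "0 \<le> L"
  shows "(\<integral>\<^sup>+ u. ennreal (overlap L (u :: real ^ 'n::finite)) \<partial>lborel) = ennreal (L ^ Suc CARD('n))"
proof -
  define A where "A = {(u :: real ^ 'n, s). s \<in> translations_within L u}"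
  have "closed A"
    unfolding A_def translations_within_def case_prod_beta mem_Collect_eq
    by (intro closed_Collect_conj closed_Collect_all closed_Collect_le continuous_intros)
  then have A [measurable]: "A \<in> sets (borel \<Otimes>\<^sub>M borel)"
    unfolding borel_prod by (rule borel_closed)
  have box: "{u. (u, s) \<in> A} = cbox (vec (s - L)) (vec s)" if "s \<in> {0..L}" for s
    using that by (auto simp: A_def translations_within_def mem_box_cart algebra_simps)
  have empty: "{u. (u, s) \<in> A} = {}" if "s \<notin> {0..L}" for s
    using that by (auto simp: A_def translations_within_def)
  have vol: "emeasure lborel (cbox (vec (s - L)) (vec s) :: (real ^ 'n) set) = ennreal (L ^ CARD('n))" for s
  proof -
    have "emeasure lborel (cbox (vec (s - L)) (vec s) :: (real ^ 'n) set) =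
          ennreal (measure lborel (cbox (vec (s - L)) (vec s) :: (real ^ 'n) set))"
      by (rule emeasure_eq_ennreal_measure) (metis emeasure_lborel_cbox_finite infinity_ennreal_def less_irrefl)
    also have "measure lborel (cbox (vec (s - L)) (vec s) :: (real ^ 'n) set) = L ^ CARD('n)"
      using assms by (subst content_cbox_cart) (auto simp: interval_ne_empty_cart)
    finally show ?thesis .
  qed
  have "(\<integral>\<^sup>+ u. ennreal (overlap L (u :: real ^ 'n)) \<partial>lborel) =
        (\<integral>\<^sup>+ u. (\<integral>\<^sup>+ s. indicator A (u, s) \<partial>lborel) \<partial>lborel)"
  proof (intro nn_integral_cong)
    fix u :: "real ^ 'n"
    have "(\<integral>\<^sup>+ s. indicator A (u, s) \<partial>lborel) =
          (\<integral>\<^sup>+ s. indicator (translations_within L u) s \<partial>lborel)"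
      by (intro nn_integral_cong) (auto simp: A_def split: split_indicator)
    also have "\<dots> = emeasure lborel (translations_within L u)"
      by (simp add: translations_within_eq)
    also have "\<dots> = ennreal (overlap L u)"
      by (simp add: overlap_def translations_within_eq emeasure_eq_ennreal_measure)
    finally show "ennreal (overlap L u) = (\<integral>\<^sup>+ s. indicator A (u, s) \<partial>lborel)" ..
  qed
  also have "\<dots> = (\<integral>\<^sup>+ s. (\<integral>\<^sup>+ u. indicator A (u, s) \<partial>lborel) \<partial>lborel)"
    by (rule lborel_pair.Fubini'[symmetric]) (simp add: measurable_cong_sets[OF sets_pair_measure_cong[OF sets_lborel sets_lborel] refl])
  also have "\<dots> = (\<integral>\<^sup>+ s. ennreal (L ^ CARD('n)) * indicator {0..L} s \<partial>lborel)"
  proof (intro nn_integral_cong)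
    fix s :: real
    have "(\<integral>\<^sup>+ u. indicator A (u, s) \<partial>lborel) = (\<integral>\<^sup>+ u. indicator {u. (u, s) \<in> A} u \<partial>lborel)"
      by (intro nn_integral_cong) (auto split: split_indicator)
    also have "\<dots> = emeasure lborel {u. (u, s) \<in> A}"
      using box empty by (cases "s \<in> {0..L}") auto
    also have "\<dots> = ennreal (L ^ CARD('n)) * indicator {0..L} s"
      using box empty vol by (cases "s \<in> {0..L}") auto
    finally show "(\<integral>\<^sup>+ u. indicator A (u, s) \<partial>lborel) = ennreal (L ^ CARD('n)) * indicator {0..L} s" .
  qed
  also have "\<dots> = ennreal (L ^ Suc CARD('n))"
    using assms by (simp add: nn_integral_cmult ennreal_mult'[symmetric] mult.commute)
  finally show ?thesis .
qed

lemma integral_overlap: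
  assumes "0 \<le> L"
  shows "(\<integral> u. overlap L (u :: real ^ 'n::finite) \<partial>lborel) = L ^ Suc CARD('n)"
proof -
  have "overlap L \<in> borel_measurable (borel :: (real ^ 'n) measure)"
    by (rule borel_measurable_continuous_onI) (rule continuous_on_overlap)
  then show ?thesis
    using assms by (subst integral_eq_nn_integral) (auto simp: nn_integral_overlap overlap_nonneg simp del: power_Suc)
qed

text \<open>The hypothesis on correlations enters the proof only here, through one kernel for each
  \<open>L\<close>.\<close>

lemma correlation_overlap_tendsto:
  fixes x :: "nat \<Rightarrow> real"
  assumes "poissonian_correlations TYPE('n::finite) x" "0 \<le> L"
  shows "correlation x (overlap L :: real ^ 'n \<Rightarrow> real) \<longlonglongrightarrow> L ^ Suc CARD('n)"
proof -
  have "correlation x (overlap L :: real ^ 'n \<Rightarrow> real) \<longlonglongrightarrow> integral\<^sup>L lborel (overlap L :: real ^ 'n \<Rightarrow> real)"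
    using assms(1) continuous_on_overlap compact_support_overlap overlap_nonneg
    unfolding poissonian_correlations_def by blast
  then show ?thesis
    unfolding integral_overlap[OF assms(2)] .
qed

section \<open>Tuples of distinct indices and short signed distances\<close>

lemma card_distinct_tuples:
  fixes S :: "nat set"
  assumes "finite S"
  shows "(card S - CARD('n::finite)) ^ Suc CARD('n)
    \<le> card {(i, j :: 'n \<Rightarrow> nat). i \<in> S \<and> (\<forall>m. j m \<in> S) \<and> (\<forall>m. j m \<noteq> i) \<and> inj j}"
proof -
  let ?d = "CARD('n)"
  define J where "J i = {j \<in> (UNIV :: 'n set) \<rightarrow>\<^sub>E S - {i}. inj j}" for i
  have eq: "{(i, j :: 'n \<Rightarrow> nat). i \<in> S \<and> (\<forall>m. j m \<in> S) \<and> (\<forall>m. j m \<noteq> i) \<and> inj j} = Sigma S J"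
    by (auto simp: J_def PiE_UNIV_domain Pi_iff)
  have fin: "finite (J i)" for i
    using assms by (auto simp: J_def intro: finite_subset[OF _ finite_PiE[of UNIV "\<lambda>_. S - {i}"]])
  have J: "(card S - ?d) ^ ?d \<le> card (J i)" if "i \<in> S" for i
  proof -
    have "(card S - ?d) ^ ?d = (\<Prod>l\<in>{0..<?d}. card S - ?d)"
      by simp
    \<comment> \<open>The falling factorial counts injections into \<open>S - {i}\<close>. As
      \<open>l < ?d\<close>, each factor \<open>card S - 1 - l\<close> is at least
      \<open>card S - ?d\<close>, where subtraction truncates at 0.\<close>
    also have "\<dots> \<le> (\<Prod>l\<in>{0..<?d}. card (S - {i}) - l)"
      using assms that by (intro prod_mono) auto
    also have "\<dots> = card (J i)"
      using assms by (simp add: J_def card_inj_on_subset_funcset)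
    finally show ?thesis .
  qed
  have "(card S - ?d) ^ Suc ?d \<le> card S * (card S - ?d) ^ ?d"
    by simp
  also have "\<dots> = (\<Sum>i\<in>S. (card S - ?d) ^ ?d)"
    by simp
  also have "\<dots> \<le> (\<Sum>i\<in>S. card (J i))"
    by (intro sum_mono J)
  also have "\<dots> = card (Sigma S J)"
    using assms fin by simp
  finally show ?thesis
    unfolding eq .
qed

lemma finite_distinct_indices: "finite (distinct_indices N :: (nat \<times> ('n::finite \<Rightarrow> nat)) set)"
proof (rule finite_subset)
  show "distinct_indices N \<subseteq> {1..N} \<times> ((UNIV :: 'n set) \<rightarrow>\<^sub>E {1..N})"
    by (auto simp: distinct_indices_def)
  show "finite ({1..N} \<times> ((UNIV :: 'n set) \<rightarrow>\<^sub>E {1..N}))"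
    by (intro finite_SigmaI finite_PiE) auto
qed

lemma signed_dist_eq_self:
  assumes "\<bar>t\<bar> < 1 / 2"
  shows "signed_dist t = t"
proof (cases "0 \<le> t")
  case True
  then have "frac t = t"
    using assms by (simp add: frac_eq)
  then show ?thesis
    using assms by (simp add: signed_dist_def)
next
  case False
  \<comment> \<open>Since \<open>t > - 1 / 2\<close>, this exceeds \<open>1 / 2\<close>, so the
    second branch of the definition returns \<open>t\<close>.\<close>
  then have "frac t = t + 1"
    using assms by (intro frac_unique_iff[THEN iffD2]) auto
  then show ?thesis
    using assms by (simp add: signed_dist_def)
qed

section \<open>Points caught by a sliding window, and their moment bound\<close>

definition hits :: "(nat \<Rightarrow> real) \<Rightarrow> nat \<Rightarrow> real \<Rightarrow> real \<Rightarrow> nat set" where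
  "hits x N h t = {n \<in> {1..N}. t \<le> x n \<and> x n \<le> t + h}"

lemma finite_hits [simp]: "finite (hits x N h t)"
  by (simp add: hits_def)

lemma card_hits_le: "card (hits x N h t) \<le> N"
proof -
  have "card (hits x N h t) \<le> card {1..N}"
    by (intro card_mono) (auto simp: hits_def)
  then show ?thesis
    by simp
qed

text \<open>Seen from the point instead of the window: \<open>x n\<close> is caught exactly by the
  windows starting in \<open>{x n - h..x n}\<close>. Measurability and integrals in \<open>t\<close>
  follow from this form.\<close>

lemma card_hits_eq_sum: "real (card (hits x N h t)) = (\<Sum>n\<in>{1..N}. indicator {x n - h..x n} t)"
proof -
  have "(\<Sum>n\<in>{1..N}. indicator {x n - h..x n} t) = (\<Sum>n\<in>{1..N}. if n \<in> hits x N h t then 1 else 0 :: real)"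
    by (intro sum.cong) (auto simp: hits_def split: split_indicator)
  also have "\<dots> = real (card ({1..N} \<inter> hits x N h t))"
    by (simp add: sum.inter_restrict[symmetric])
  also have "{1..N} \<inter> hits x N h t = hits x N h t"
    by (auto simp: hits_def)
  finally show ?thesis ..
qed

lemma card_hits_measurable [measurable]: "(\<lambda>t. real (card (hits x N h t))) \<in> borel_measurable borel"
  unfolding card_hits_eq_sum by measurable

text \<open>The integrand is at most the number of tuples caught by the window at \<open>t\<close>.
  The starting points catching a given tuple form a set \<open>T i j\<close> of length at most the
  kernel value divided by \<open>N\<close>, and summing over tuples yields the correlation.\<close>

lemma nn_integral_hits_le_correlation:
  fixes x :: "nat \<Rightarrow> real"
  assumes "N > 0" "L > 0" "L / real N < 1 / 2"
  shows "(\<integral>\<^sup>+ t. ennreal (real ((card (hits x N (L / real N) t) - CARD('n)) ^ Suc CARD('n))) \<partial>lborel)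
    \<le> ennreal (correlation x (overlap L :: real ^ 'n::finite \<Rightarrow> real) N)"
proof -
  define h where "h = L / real N"
  define T where "T i j = {t. i \<in> hits x N h t \<and> (\<forall>m. j m \<in> hits x N h t)}"
    for i and j :: "'n \<Rightarrow> nat"
  define u where "u i j = (\<chi> m. real N * signed_dist (x i - x (j m)))"
    for i and j :: "'n \<Rightarrow> nat"
  let ?I = "distinct_indices N :: (nat \<times> ('n \<Rightarrow> nat)) set"
  have closed: "closed (T i j)" for i j
    unfolding T_def hits_def mem_Collect_eq
    by (intro closed_Collect_conj closed_Collect_all closed_Collect_le closed_Collect_const continuous_intros)
  then have T [measurable]: "T i j \<in> sets borel" for i j
    by (rule borel_closed)
  \<comment> \<open>Only an inequality: points near opposite ends of \<open>[0, 1]\<close> are close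
    modulo 1 and may have positive overlap although no short window catches them.\<close>
  have volume: "emeasure lborel (T i j) \<le> ennreal (overlap L (u i j) / real N)" for i j
  proof (cases "T i j = {}")
    case False
    then obtain t where t: "t \<in> T i j"
      by blast
    have "signed_dist (x i - x (j m)) = x i - x (j m)" for m
    proof (rule signed_dist_eq_self)
      have "i \<in> hits x N h t" "j m \<in> hits x N h t"
        using t by (auto simp: T_def)
      then show "\<bar>x i - x (j m)\<bar> < 1 / 2"
        using assms(3) unfolding hits_def h_def[symmetric] mem_Collect_eq by linarith
    qed
    then have u: "u i j $ m = real N * (x i - x (j m))" for m
      by (simp add: u_def)
    \<comment> \<open>Substituting \<open>t = x i - s / N\<close> turns
      \<open>t \<le> x i \<le> t + h\<close> into \<open>0 \<le> s \<le> L\<close>, and the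
      condition on \<open>x (j m)\<close> into the one on the translate by
      \<open>u i j $ m\<close>.\<close>
    have rescale: "x i + (- 1 / real N) * s \<in> T i j \<longleftrightarrow> s \<in> translations_within L (u i j)" for s
    proof -
      have "i \<in> {1..N}" "\<And>m. j m \<in> {1..N}"
        using t by (auto simp: T_def hits_def)
      moreover have "x i - s / real N \<le> y \<longleftrightarrow> 0 \<le> s - real N * (x i - y)"
        and "y \<le> x i - s / real N + h \<longleftrightarrow> s - real N * (x i - y) \<le> L" for y
        using assms(1) by (auto simp: h_def field_simps)
      ultimately show ?thesis
        unfolding T_def hits_def translations_within_def u by auto
    qed
    have "emeasure lborel (T i j) = (\<integral>\<^sup>+ t. indicator (T i j) t \<partial>lborel)"
      by simp
    also have "\<dots> = ennreal \<bar>- 1 / real N\<bar> * (\<integral>\<^sup>+ s. indicator (T i j) (x i + (- 1 / real N) * s) \<partial>lborel)"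
      using assms(1) by (intro nn_integral_real_affine) auto
    also have "(\<lambda>s. indicator (T i j) (x i + (- 1 / real N) * s) :: ennreal) =
               indicator (translations_within L (u i j))"
      using rescale by (auto simp: fun_eq_iff indicator_def)
    also have "(\<integral>\<^sup>+ s. indicator (translations_within L (u i j)) s \<partial>lborel) = ennreal (overlap L (u i j))"
      by (simp add: overlap_def translations_within_eq emeasure_eq_ennreal_measure)
    also have "ennreal \<bar>- 1 / real N\<bar> * \<dots> = ennreal (overlap L (u i j) / real N)"
      by (simp add: ennreal_mult'[symmetric])
    finally show ?thesis
      by simp
  qed simp
  have count: "real ((card (hits x N h t) - CARD('n)) ^ Suc CARD('n)) \<le> (\<Sum>(i, j)\<in>?I. indicator (T i j) t)" for t
  proof -
    have "(card (hits x N h t) - CARD('n)) ^ Suc CARD('n) \<le>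
      card {(i, j :: 'n \<Rightarrow> nat). i \<in> hits x N h t \<and> (\<forall>m. j m \<in> hits x N h t) \<and> (\<forall>m. j m \<noteq> i) \<and> inj j}"
      by (rule card_distinct_tuples) simp
    also have "{(i, j :: 'n \<Rightarrow> nat). i \<in> hits x N h t \<and> (\<forall>m. j m \<in> hits x N h t) \<and> (\<forall>m. j m \<noteq> i) \<and> inj j} =
      ?I \<inter> {(i, j). t \<in> T i j}"
      by (auto simp: distinct_indices_def T_def hits_def)
    finally have "real ((card (hits x N h t) - CARD('n)) ^ Suc CARD('n)) \<le> real (card (?I \<inter> {(i, j). t \<in> T i j}))"
      by (rule of_nat_mono)
    also have "\<dots> = (\<Sum>p\<in>?I. indicator {(i, j). t \<in> T i j} p)"
      by (simp add: indicator_def of_bool_def sum.If_cases[OF finite_distinct_indices])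
    also have "\<dots> = (\<Sum>(i, j)\<in>?I. indicator (T i j) t)"
      by (intro sum.cong) (auto split: split_indicator)
    finally show ?thesis .
  qed
  have "(\<integral>\<^sup>+ t. ennreal (real ((card (hits x N h t) - CARD('n)) ^ Suc CARD('n))) \<partial>lborel) \<le>
        (\<integral>\<^sup>+ t. (\<Sum>(i, j)\<in>?I. indicator (T i j) t) \<partial>lborel)"
  proof (rule nn_integral_mono)
    fix t :: real
    have "ennreal (real ((card (hits x N h t) - CARD('n)) ^ Suc CARD('n))) \<le>
          ennreal (\<Sum>(i, j)\<in>?I. indicator (T i j) t)"
      by (rule ennreal_leI) (rule count)
    also have "\<dots> = (\<Sum>(i, j)\<in>?I. indicator (T i j) t)"
      by (subst sum_ennreal[symmetric]) (auto simp: case_prod_beta ennreal_indicator)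
    finally show "ennreal (real ((card (hits x N h t) - CARD('n)) ^ Suc CARD('n))) \<le>
                  (\<Sum>(i, j)\<in>?I. indicator (T i j) t)" .
  qed
  also have "\<dots> = (\<Sum>(i, j)\<in>?I. emeasure lborel (T i j))"
    unfolding case_prod_beta by (subst nn_integral_sum) auto
  also have "\<dots> \<le> (\<Sum>(i, j)\<in>?I. ennreal (overlap L (u i j) / real N))"
    unfolding case_prod_beta by (intro sum_mono volume)
  also have "\<dots> = ennreal (\<Sum>(i, j)\<in>?I. overlap L (u i j) / real N)"
    unfolding case_prod_beta by (intro sum_ennreal) (simp add: overlap_nonneg)
  also have "(\<Sum>(i, j)\<in>?I. overlap L (u i j) / real N) =
      correlation x (overlap L :: real ^ 'n \<Rightarrow> real) N"
    by (simp add: correlation_def u_def sum_divide_distrib case_prod_beta)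
  finally show ?thesis
    unfolding h_def .
qed

section \<open>Integrals over bounded intervals\<close>

lemma set_integrable_interval_bounded:
  fixes f :: "real \<Rightarrow> real"
  assumes "f \<in> borel_measurable borel" "\<And>t. \<bar>f t\<bar> \<le> B"
  shows "set_integrable lborel {a..b} f"
  unfolding set_integrable_def using assms
  by (intro integrableI_bounded_set_indicator[where B = B]) (auto simp: emeasure_lborel_Icc_eq)

lemma set_integral_const_interval:
  fixes a b c :: real
  shows "(LINT t:{a..b}|lborel. c) = max 0 (b - a) * c"
  by (cases "a \<le> b") (auto simp: set_lebesgue_integral_def)

lemma set_integral_card_hits:
  "(LINT t:{a..b}|lborel. real (card (hits x N h t))) = (\<Sum>n\<in>{1..N}. measure lborel ({x n - h..x n} \<inter> {a..b}))"
proof -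
  have "(LINT t:{a..b}|lborel. real (card (hits x N h t))) =
        (\<integral> t. (\<Sum>n\<in>{1..N}. indicator ({x n - h..x n} \<inter> {a..b}) t) \<partial>lborel)"
    unfolding set_lebesgue_integral_def card_hits_eq_sum
    by (intro Bochner_Integration.integral_cong) (simp_all add: sum_distrib_left indicator_inter_arith mult.commute del: Int_atLeastAtMost)
  also have "\<dots> = (\<Sum>n\<in>{1..N}. measure lborel ({x n - h..x n} \<inter> {a..b}))"
    by (subst Bochner_Integration.integral_sum)
      (auto intro!: integrable_real_indicator simp: emeasure_lborel_Icc_eq)
  finally show ?thesis .
qed

section \<open>Quantitative Bernoulli inequality\<close>

lemma quadratic_lower_bound_power:
  fixes z :: real
  assumes "0 \<le> z" "1 \<le> k"
  shows "(z - 1)\<^sup>2 \<le> z ^ Suc k - 1 - real (Suc k) * (z - 1)"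
proof -
  \<comment> \<open>Bernoulli's inequality multiplied by \<open>z\<close> bounds the right-hand side
    of the claim below by exactly \<open>k * (z - 1)^2\<close>.\<close>
  have "0 \<le> z * (z ^ k - 1 - real k * (z - 1))"
    using assms Bernoulli_inequality[of "z - 1" k] by (intro mult_nonneg_nonneg) auto
  moreover have "(z - 1)\<^sup>2 \<le> real k * (z - 1)\<^sup>2"
    using assms(2) by (simp add: mult_le_cancel_right1)
  ultimately show ?thesis
    by (simp add: algebra_simps power2_eq_square)
qed

text \<open>Either \<open>|z - 1| \<le> \<delta>\<close>, or
  \<open>|z - 1| \<le> (z - 1)^2 / \<delta>\<close>. The free parameter lets a bound on moments
  become a bound on the mean deviation from 1.\<close>

lemma abs_minus_one_le_power:
  fixes z \<delta> :: real
  assumes "0 \<le> z" "1 \<le> k" "\<delta> > 0"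
  shows "\<bar>z - 1\<bar> \<le> \<delta> + (z ^ Suc k - 1 - real (Suc k) * (z - 1)) / \<delta>"
proof -
  have "\<bar>z - 1\<bar> * \<delta> \<le> \<delta> * \<delta> + (z - 1)\<^sup>2"
  proof (cases "\<bar>z - 1\<bar> \<le> \<delta>")
    case True
    then have "\<bar>z - 1\<bar> * \<delta> \<le> \<delta> * \<delta>"
      using assms(3) by (intro mult_right_mono) auto
    then show ?thesis
      using zero_le_power2[of "z - 1"] by linarith
  next
    case False
    then have "\<bar>z - 1\<bar> * \<delta> \<le> \<bar>z - 1\<bar> * \<bar>z - 1\<bar>"
      by (intro mult_left_mono) auto
    then show ?thesis
      using mult_pos_pos[OF assms(3,3)] by (simp add: power2_eq_square)
  qed
  also have "\<dots> \<le> \<delta> * \<delta> + (z ^ Suc k - 1 - real (Suc k) * (z - 1))"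
    using quadratic_lower_bound_power[OF assms(1,2)] by simp
  finally have "\<bar>z - 1\<bar> \<le> (\<delta> * \<delta> + (z ^ Suc k - 1 - real (Suc k) * (z - 1))) / \<delta>"
    using assms(3) by (simp only: pos_le_divide_eq)
  then show ?thesis
    using assms(3) by (simp only: add_divide_distrib nonzero_mult_div_cancel_right)
qed

section \<open>Deviation of the empirical measure for fixed \<open>N\<close>\<close>

text \<open>The terms down to the quotient by \<open>\<delta>\<close> bound the mean deviation
  \<open>D\<close> of \<open>W\<close> from 1. The summand \<open>h\<close> comes from moving the
  endpoints of \<open>[a, b]\<close>, and the last one from the \<open>d\<close> points removed in
  \<open>W\<close>.\<close>

lemma empirical_measure_deviation:
  fixes x :: "nat \<Rightarrow> real" and L \<delta> a b :: real
  defines "d \<equiv> real CARD('n::finite)"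
  assumes x: "\<And>n. n \<ge> 1 \<Longrightarrow> x n \<in> {0..1}"
    and N: "N > 0" and L: "L > 0" and h: "h = L / real N" "h < 1 / 2" and \<delta>: "\<delta> > 0"
    and ab: "0 \<le> a" "a < b" "b \<le> 1"
  shows "\<bar>(1 / real N) * real (card {n \<in> {1..N}. a \<le> x n \<and> x n \<le> b}) - (b - a)\<bar> \<le>
    \<delta> * (1 + h)
    + (correlation x (overlap L :: real ^ 'n \<Rightarrow> real) N / L ^ Suc CARD('n)
       - (1 + h) - (d + 1) * (1 - d * (1 + h) / L) + (d + 1) * (1 + h)) / \<delta>
    + h + (1 + h) * d / L"
proof -
  define Y where "Y t = real (card (hits x N h t))" for t
  define W where "W t = real (card (hits x N h t) - CARD('n)) / L" for t
  define R where "R = correlation x (overlap L :: real ^ 'n \<Rightarrow> real) N"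
  \<comment> \<open>Every window meeting \<open>[0, 1]\<close> starts in this interval, so each
    point contributes its full length \<open>h\<close> and \<open>Y\<close> has integral exactly
    \<open>N * h = L\<close>.\<close>
  let ?E = "{- h..1 :: real}"
  let ?k = "Suc CARD('n)"
  define D where "D = (LINT t:?E|lborel. \<bar>W t - 1\<bar>)"
  have hpos: "h > 0"
    using N L h by simp
  have k: "real ?k = d + 1"
    by (simp add: d_def)
  have d: "d \<ge> 0" "1 \<le> CARD('n)"
    by (auto simp: d_def Suc_le_eq)
  have W: "W t = max 0 (Y t - d) / L" for t
    unfolding W_def Y_def d_def by (cases "card (hits x N h t) \<le> CARD('n)") auto
  have Wpos: "0 \<le> W t" for t
    using L by (simp add: W_def)
  have meas [measurable]: "Y \<in> borel_measurable borel" "W \<in> borel_measurable borel"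
    unfolding W[abs_def] Y_def[abs_def] by measurable
  have Y_bound: "\<bar>Y t\<bar> \<le> real N" for t
    by (simp add: Y_def card_hits_le)
  have W_bound: "\<bar>W t\<bar> \<le> real N / L" for t
    using L Y_bound[of t] d(1) by (auto simp: W Y_def intro!: divide_right_mono)
  have int_Y: "set_integrable lborel {p..q} Y" for p q
    using meas(1) Y_bound by (rule set_integrable_interval_bounded)
  have int_W: "set_integrable lborel {p..q} W" for p q
    using meas(2) W_bound by (rule set_integrable_interval_bounded)
  have int_Wk: "set_integrable lborel {p..q} (\<lambda>t. W t ^ ?k)" for p q
  proof (rule set_integrable_interval_bounded)
    show "\<bar>W t ^ ?k\<bar> \<le> (real N / L) ^ ?k" for t
      unfolding power_abs by (rule power_mono[OF W_bound]) simp
  qed measurable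
  have int_const: "set_integrable lborel {p..q} (\<lambda>t. c)" for p q c :: real
    by (rule set_integrable_interval_bounded[where B = "\<bar>c\<bar>"]) auto
  have int_abs: "set_integrable lborel {p..q} (\<lambda>t. \<bar>W t - 1\<bar>)" for p q
    by (intro set_integrable_abs set_integral_diff int_W int_const)

  have mean_Y: "(LINT t:?E|lborel. Y t) = L"
  proof -
    have "measure lborel ({x n - h..x n} \<inter> ?E) = h" if "n \<in> {1..N}" for n
    proof -
      have "{x n - h..x n} \<inter> ?E = {x n - h..x n}"
        using x[of n] that by auto
      then show ?thesis
        using hpos by simp
    qed
    then show ?thesis
      unfolding Y_def set_integral_card_hits using N by (simp add: h)
  qed
  have mean_W: "1 - d * (1 + h) / L \<le> (LINT t:?E|lborel. W t)"
  proof -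
    have "1 - d * (1 + h) / L = (LINT t:?E|lborel. Y t / L - d / L)"
      using L hpos int_Y[of "- h" 1]
      by (simp add: int_const mean_Y set_integral_const_interval algebra_simps)
    also have "\<dots> \<le> (LINT t:?E|lborel. W t)"
      using L by (intro set_integral_mono set_integral_diff set_integrable_divide int_Y int_W int_const)
        (auto simp: W diff_divide_distrib[symmetric] intro!: divide_right_mono)
    finally show ?thesis .
  qed
  have moment_W: "(LINT t:?E|lborel. W t ^ ?k) \<le> R / L ^ ?k"
  proof -
    have R: "0 \<le> R"
      by (auto simp: R_def correlation_def overlap_nonneg intro!: sum_nonneg divide_nonneg_nonneg)
    \<comment> \<open>Dropping the indicator extends the integral to the whole line, where the
      correlation bound applies.\<close>
    have "(\<integral>\<^sup>+ t. ennreal (indicator ?E t *\<^sub>R (W t ^ ?k)) \<partial>lborel) \<le>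
      (\<integral>\<^sup>+ t. ennreal (1 / L ^ ?k) * ennreal (real ((card (hits x N h t) - CARD('n)) ^ ?k)) \<partial>lborel)"
      using L by (intro nn_integral_mono)
        (auto simp: W_def power_divide ennreal_mult'[symmetric] simp del: power_Suc split: split_indicator)
    also have "\<dots> = ennreal (1 / L ^ ?k) * (\<integral>\<^sup>+ t. ennreal (real ((card (hits x N h t) - CARD('n)) ^ ?k)) \<partial>lborel)"
    proof (rule nn_integral_cmult)
      have "real ((card (hits x N h t) - CARD('n)) ^ ?k) = (W t * L) ^ ?k" for t
        using L by (simp add: W_def del: power_Suc)
      then show "(\<lambda>t. ennreal (real ((card (hits x N h t) - CARD('n)) ^ ?k))) \<in> borel_measurable lborel"
        by (simp del: power_Suc of_nat_power)
    qed
    also have "\<dots> \<le> ennreal (1 / L ^ ?k) * ennreal R"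
      unfolding R_def using nn_integral_hits_le_correlation[OF N L, of x, where 'n = 'n] h
      by (intro mult_left_mono) auto
    also have "\<dots> = ennreal (R / L ^ ?k)"
      using L by (simp add: ennreal_mult'[symmetric] del: power_Suc)
    finally have "enn2real (\<integral>\<^sup>+ t. ennreal (indicator ?E t *\<^sub>R (W t ^ ?k)) \<partial>lborel) \<le> R / L ^ ?k"
      using L R by (intro enn2real_leI) (auto simp del: power_Suc)
    moreover have "(LINT t:?E|lborel. W t ^ ?k) =
        enn2real (\<integral>\<^sup>+ t. ennreal (indicator ?E t *\<^sub>R (W t ^ ?k)) \<partial>lborel)"
      unfolding set_lebesgue_integral_def
      by (rule integral_eq_nn_integral) (auto simp: Wpos simp del: power_Suc)
    ultimately show ?thesis
      by simp
  qed

  have D: "D \<le> \<delta> * (1 + h) +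
     (R / L ^ ?k - (1 + h) - (d + 1) * (1 - d * (1 + h) / L) + (d + 1) * (1 + h)) / \<delta>"
  proof -
    have "D \<le> (LINT t:?E|lborel. \<delta> + (W t ^ ?k - 1 - real ?k * (W t - 1)) / \<delta>)"
      unfolding D_def using \<delta> d Wpos
      by (intro set_integral_mono int_abs set_integral_add set_integral_diff set_integrable_divide
          set_integrable_mult_right int_W int_Wk int_const abs_minus_one_le_power) auto
    also have "\<dots> = \<delta> * (1 + h) + ((LINT t:?E|lborel. W t ^ ?k) - (1 + h)
        - (d + 1) * ((LINT t:?E|lborel. W t) - (1 + h))) / \<delta>"
      unfolding k using hpos
      by (simp add: int_const int_W int_Wk set_integral_add set_integral_diff set_integral_const_interval mult.commute del: power_Suc)
    \<comment> \<open>The moment enters with positive sign and the mean with negative sign, so the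
      upper bound for the one and the lower bound for the other suffice.\<close>
    also have "\<dots> \<le> \<delta> * (1 + h) +
       (R / L ^ ?k - (1 + h) - (d + 1) * ((1 - d * (1 + h) / L) - (1 + h))) / \<delta>"
      using moment_W mean_W d \<delta>
      by (intro add_left_mono divide_right_mono diff_mono mult_left_mono) auto
    finally show ?thesis
      by (simp only: algebra_simps)
  qed
  have D_subset: "(LINT t:{p..q}|lborel. \<bar>W t - 1\<bar>) \<le> D" if "- h \<le> p" "q \<le> 1" for p q
    unfolding D_def set_lebesgue_integral_def
    using int_abs that by (intro integral_mono) (auto simp: set_integrable_def split: split_indicator)

  let ?C = "{n \<in> {1..N}. a \<le> x n \<and> x n \<le> b}"
  have card_C: "real (card ?C) * h = (\<Sum>n\<in>{1..N}. if n \<in> ?C then h else 0)"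
  proof -
    have "(\<Sum>n\<in>{1..N}. if n \<in> ?C then h else 0) = (\<Sum>n\<in>{1..N} \<inter> ?C. h)"
      by (rule sum.inter_restrict[symmetric]) simp
    also have "{1..N} \<inter> ?C = ?C"
      by auto
    finally show ?thesis
      by simp
  qed
  \<comment> \<open>A point of \<open>[a, b]\<close> has all its starting points in
    \<open>[a - h, b]\<close>.\<close>
  have upper: "real (card ?C) * h \<le> (LINT t:{a - h..b}|lborel. Y t)"
    unfolding card_C Y_def set_integral_card_hits
  proof (rule sum_mono)
    fix n
    have "{x n - h..x n} \<inter> {a - h..b} = {x n - h..x n}" if "n \<in> ?C"
      using that by auto
    then show "(if n \<in> ?C then h else 0) \<le> measure lborel ({x n - h..x n} \<inter> {a - h..b})"
      using hpos by simp
  qed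
  \<comment> \<open>A point outside \<open>[a, b]\<close> has no starting point in
    \<open>[a, b - h]\<close>; that interval may be empty.\<close>
  have lower: "(LINT t:{a..b - h}|lborel. Y t) \<le> real (card ?C) * h"
    unfolding card_C Y_def set_integral_card_hits
  proof (rule sum_mono)
    fix n assume n: "n \<in> {1..N}"
    have "measure lborel ({x n - h..x n} \<inter> {a..b - h}) \<le> measure lborel {x n - h..x n}"
      by (intro measure_mono_fmeasurable fmeasurableI) (auto simp: emeasure_lborel_Icc_eq)
    moreover have "{x n - h..x n} \<inter> {a..b - h} = {}" if "n \<notin> ?C"
      using that n by auto
    ultimately show "measure lborel ({x n - h..x n} \<inter> {a..b - h}) \<le> (if n \<in> ?C then h else 0)"
      using hpos by (cases "n \<in> ?C") auto
  qed
  have scale: "(1 / real N) * real (card ?C) = real (card ?C) * h / L"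
    using N L by (simp add: h)

  \<comment> \<open>Upper estimate: \<open>Y \<le> L * W + d\<close> costs \<open>d / L\<close> per
    unit length, over an interval of length at most \<open>1 + h\<close>.\<close>
  have "real (card ?C) * h / L \<le> (LINT t:{a - h..b}|lborel. Y t / L)"
    using upper L by (simp add: divide_right_mono)
  also have "\<dots> \<le> (LINT t:{a - h..b}|lborel. \<bar>W t - 1\<bar> + (1 + d / L))"
  proof (intro set_integral_mono set_integral_add set_integrable_divide int_Y int_abs int_const)
    fix t
    have "Y t / L \<le> W t + d / L"
      using L by (auto simp: W add_divide_distrib[symmetric] intro!: divide_right_mono)
    then show "Y t / L \<le> \<bar>W t - 1\<bar> + (1 + d / L)"
      by linarith
  qed
  also have "\<dots> = (LINT t:{a - h..b}|lborel. \<bar>W t - 1\<bar>) + (b - a + h) * (1 + d / L)"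
    using ab hpos int_abs int_const by (simp add: set_integral_add set_integral_const_interval)
  also have "\<dots> \<le> D + (b - a + h) + (b - a + h) * (d / L)"
    using D_subset[of "a - h" b] ab by (simp add: algebra_simps)
  also have "(b - a + h) * (d / L) \<le> (1 + h) * (d / L)"
    using ab hpos d L by (intro mult_right_mono) auto
  finally have U: "real (card ?C) * h / L - (b - a) \<le> D + h + (1 + h) * d / L"
    by simp

  \<comment> \<open>Lower estimate: \<open>W \<le> Y / L\<close> loses nothing. If
    \<open>b - h < a\<close>, the integral is 0 and the bound holds trivially.\<close>
  have "(b - h - a) - D \<le> (LINT t:{a..b - h}|lborel. 1 - \<bar>W t - 1\<bar>)"
    using D_subset[of a "b - h"] ab hpos int_abs int_const
    by (simp add: set_integral_diff set_integral_const_interval)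
  also have "\<dots> \<le> (LINT t:{a..b - h}|lborel. Y t / L)"
  proof (intro set_integral_mono set_integral_diff set_integrable_divide int_Y int_abs int_const)
    fix t
    have "W t \<le> Y t / L"
      using L d(1) by (auto simp: W Y_def intro!: divide_right_mono)
    then show "1 - \<bar>W t - 1\<bar> \<le> Y t / L"
      by linarith
  qed
  also have "\<dots> \<le> real (card ?C) * h / L"
    using lower L by (simp add: divide_right_mono)
  finally have "- (D + h) \<le> real (card ?C) * h / L - (b - a)"
    by simp
  moreover have "0 \<le> (1 + h) * d / L"
    using hpos d L by simp
  ultimately show ?thesis
    unfolding scale using U D unfolding R_def by linarith
qed

section \<open>Passage to the limit\<close>

theorem theorem1:
  fixes k :: nat and x :: "nat \<Rightarrow> real"
  assumes "k \<ge> 2"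
    and "CARD('n::finite) = k - 1"
    and "\<And>n. n \<ge> 1 \<Longrightarrow> x n \<in> {0..1}"
    and "poissonian_correlations TYPE('n) x"
  shows "uniformly_distributed x"
  unfolding uniformly_distributed_def
proof (intro allI impI, rule LIMSEQ_I)
  fix a b r :: real
  assume ab: "0 \<le> a \<and> a < b \<and> b \<le> 1" and "0 < r"
  define d where "d = real CARD('n)"
  define \<mu> where "\<mu> N = (1 / real N) * real (card {n \<in> {1..N}. a \<le> x n \<and> x n \<le> b})" for N
  \<comment> \<open>As \<open>N\<close> grows the deviation bound tends to
    \<open>\<delta> + (d + 1) * d / (L * \<delta>) + d / L\<close>. Taking \<open>L = m^2\<close>
    and \<open>\<delta> = 1 / m\<close> makes all three terms small, and gives the expression
    here.\<close>
  have "(\<lambda>m. 1 / real m + (d + 1) * d / real m + d / (real m)\<^sup>2) \<longlonglongrightarrow> 0"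
    by real_asymp
  then have "\<forall>\<^sub>F m in sequentially. 1 / real m + (d + 1) * d / real m + d / (real m)\<^sup>2 < r"
    using \<open>0 < r\<close> by (rule order_tendstoD)
  then have "\<forall>\<^sub>F m in sequentially. 0 < m \<and> 1 / real m + (d + 1) * d / real m + d / (real m)\<^sup>2 < r"
    using eventually_gt_at_top[of 0] by (rule eventually_elim2) simp
  then obtain m where m: "0 < m" "1 / real m + (d + 1) * d / real m + d / (real m)\<^sup>2 < r"
    by (auto simp: eventually_sequentially)
  define L where "L = (real m)\<^sup>2"
  define \<delta> where "\<delta> = 1 / real m"
  have L: "L > 0" and \<delta>: "\<delta> > 0"
    using m(1) by (auto simp: L_def \<delta>_def)
  define \<beta> where "\<beta> N = \<delta> * (1 + L / real N)
    + (correlation x (overlap L :: real ^ 'n \<Rightarrow> real) N / L ^ Suc CARD('n)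
       - (1 + L / real N) - (d + 1) * (1 - d * (1 + L / real N) / L) + (d + 1) * (1 + L / real N)) / \<delta>
    + L / real N + (1 + L / real N) * d / L" for N
  have h: "(\<lambda>N. L / real N) \<longlonglongrightarrow> 0"
    by real_asymp
  \<comment> \<open>\<open>L\<close> and \<open>\<delta>\<close> are already fixed in terms of
    \<open>r\<close>; only \<open>N\<close> varies. The correlation divided by the power of
    \<open>L\<close> tends to 1.\<close>
  have "\<beta> \<longlonglongrightarrow> \<delta> * (1 + 0)
    + (L ^ Suc CARD('n) / L ^ Suc CARD('n)
       - (1 + 0) - (d + 1) * (1 - d * (1 + 0) / L) + (d + 1) * (1 + 0)) / \<delta> + 0 + (1 + 0) * d / L"
    unfolding \<beta>_def[abs_def] using L \<delta> assms(4)
    by (intro tendsto_intros h correlation_overlap_tendsto) auto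
  also have "\<delta> * (1 + 0)
    + (L ^ Suc CARD('n) / L ^ Suc CARD('n)
       - (1 + 0) - (d + 1) * (1 - d * (1 + 0) / L) + (d + 1) * (1 + 0)) / \<delta> + 0 + (1 + 0) * d / L =
    1 / real m + (d + 1) * d / real m + d / (real m)\<^sup>2"
    using m(1) by (simp add: L_def \<delta>_def field_simps power2_eq_square)
  finally have "\<forall>\<^sub>F N in sequentially. \<beta> N < r"
    using m(2) by (rule order_tendstoD)
  moreover have "\<forall>\<^sub>F N in sequentially. L / real N < 1 / 2"
    using h by (rule order_tendstoD) simp
  moreover have "\<forall>\<^sub>F N in sequentially. 0 < (N :: nat)"
    by (rule eventually_gt_at_top)
  ultimately have "\<forall>\<^sub>F N in sequentially. norm (\<mu> N - (b - a)) < r"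
  proof eventually_elim
    case (elim N)
    have "\<bar>\<mu> N - (b - a)\<bar> \<le> \<beta> N"
      unfolding \<mu>_def \<beta>_def d_def using assms(3) ab L \<delta> elim
      by (intro empirical_measure_deviation) auto
    with elim show ?case
      by simp
  qed
  then show "\<exists>no. \<forall>n\<ge>no. norm ((1 / real n) * real (card {i \<in> {1..n}. a \<le> x i \<and> x i \<le> b}) - (b - a)) < r"
    by (simp add: eventually_sequentially \<mu>_def)
qed

end
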